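(* Let $K$ be a convex body in $\mathbb{R}^n$ with centroid at the origin and let $f:\partial K\to\mathbb{R}$ be an integrable, $\mu_K$-almost everywhere strictly positive function. Then: (i) $K=K^{f,0}$. (ii) There exists $s_0>0$ such that $K^{f,s}$ is bounded for all $0\le s\le s_0$.
   Context: A convex body is a compact convex set with nonempty interior. $\mu_K$ is the surface area measure on $\partial K$ and $\mu_f(A)=\int_A f\,d\mu_K$. $[x,K]$ is the convex hull of $\{x\}\cup K$. For $s\ge 0$ the illumination surface body is $$K^{f,s}=\{x\in\mathbb{R}^n:\mu_f(\partial K\cap\overline{[x,K]\setminus K})\le s\}.$$ *)

theory Defs
  imports "HOL-Analysis.Analysis"
begin

text \<open>
  Hausdorff measure of integer dimension \<open>d\<close>, normalised so that in dimension \<open>d\<close> it agrees with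
  Lebesgue measure (hence \<open>d = DIM('a) - 1\<close> gives the usual surface area). The case distinction in
  \<open>hausdorff_gauge\<close> is needed because \<open>0 ^ 0 = 1\<close>: for \<open>d = 0\<close> every nonempty set has gauge 1, so
  that one obtains counting measure, but the empty set must have gauge 0. Covering sets have to be
  bounded since \<^const>\<open>diameter\<close> is only meaningful for bounded sets.
\<close>

definition hausdorff_gauge :: "nat \<Rightarrow> 'a::metric_space set \<Rightarrow> real" where
  "hausdorff_gauge d U =
     (if U = {} then 0 else unit_ball_vol (real d) * (diameter U / 2) ^ d)"

definition hausdorff_premeasure :: "nat \<Rightarrow> real \<Rightarrow> 'a::metric_space set \<Rightarrow> ennreal" where
  "hausdorff_premeasure d \<delta> A =
     (INF U \<in> {U :: nat \<Rightarrow> 'a set. (\<forall>i. bounded (U i) \<and> diameter (U i) \<le> \<delta>) \<and> A \<subseteq> (\<Union>i. U i)}.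
        \<Sum>i. ennreal (hausdorff_gauge d (U i)))"

definition hausdorff_outer_measure :: "nat \<Rightarrow> 'a::metric_space set \<Rightarrow> ennreal" where
  "hausdorff_outer_measure d A = (SUP \<delta> \<in> {0<..}. hausdorff_premeasure d \<delta> A)"

text \<open>The measurable sets are the Caratheodory-measurable ones, so the measure is complete.\<close>

definition hausdorff_measure :: "nat \<Rightarrow> 'a::metric_space measure" where
  "hausdorff_measure d =
     measure_of UNIV (lambda_system UNIV UNIV (hausdorff_outer_measure d))
       (hausdorff_outer_measure d)"

definition surface_measure :: "'a::euclidean_space set \<Rightarrow> 'a measure" where
  "surface_measure K = restrict_space (hausdorff_measure (DIM('a) - 1)) (frontier K)"

definition convex_body :: "'a::euclidean_space set \<Rightarrow> bool" where
  "convex_body K \<longleftrightarrow> compact K \<and> convex K \<and> interior K \<noteq> {}"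

definition centroid :: "'a::euclidean_space set \<Rightarrow> 'a" where
  "centroid K = (1 / measure lborel K) *\<^sub>R (LINT x:K|lborel. x)"

text \<open>
  Functions on \<open>frontier K\<close> are represented by functions on the whole space; only their values on
  \<open>frontier K\<close>, the space of \<open>surface_measure K\<close>, play a role.
\<close>

definition weighted_surface_measure ::
  "'a::euclidean_space set \<Rightarrow> ('a \<Rightarrow> real) \<Rightarrow> 'a set \<Rightarrow> real" where
  "weighted_surface_measure K f A = (LINT y:A|surface_measure K. f y)"

definition illumination_surface_body ::
  "'a::euclidean_space set \<Rightarrow> ('a \<Rightarrow> real) \<Rightarrow> real \<Rightarrow> 'a set" where
  "illumination_surface_body K f s =
     {x. weighted_surface_measure K f
           (frontier K \<inter> closure (convex hull (insert x K) - K)) \<le> s}"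

end

theory Submission
  imports Defs
begin

text \<open>
  Let \<open>p\<close> be an interior point of \<open>K\<close>, say \<open>ball p r \<subseteq> K\<close>. If \<open>x \<notin> K\<close>, the segment from \<open>p\<close> to \<open>x\<close>
  crosses the frontier at a point \<open>y = p + \<tau> (x - p)\<close>, and every frontier point within distance
  \<open>(1 - \<tau>) r\<close> of \<open>y\<close> is interior to \<open>[x, K]\<close>, hence illuminated from \<open>x\<close>. Since relatively open pieces
  of the frontier have positive surface measure, this gives (i). If \<open>x\<close> is far away then
  \<open>\<tau> \<le> 1/2\<close>, so that the illuminated part contains one of finitely many balls of radius \<open>r/4\<close>
  covering the frontier; half of the smallest weight of these balls serves as \<open>s0\<close> in (ii).

  A piece \<open>S\<close> of the frontier has positive Hausdorff measure because translating it along a short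
  segment in the direction of \<open>p\<close> sweeps out a ball, whereas translating a set \<open>U\<close> of small diameter
  sweeps out Lebesgue measure at most a constant times \<open>diameter U ^ (n - 1)\<close>.
\<close>

subsection \<open>Hausdorff measure\<close>

lemma hausdorff_premeasure_le:
  assumes "\<And>i. bounded (U i)" "\<And>i. diameter (U i) \<le> \<delta>" "A \<subseteq> (\<Union>i::nat. U i)"
  shows "hausdorff_premeasure d \<delta> A \<le> (\<Sum>i. ennreal (hausdorff_gauge d (U i)))"
  unfolding hausdorff_premeasure_def using assms by (intro INF_lower) auto

lemma hausdorff_premeasure_greatest:
  assumes "\<And>U. \<lbrakk>\<And>i. bounded (U i); \<And>i. diameter (U i) \<le> \<delta>; A \<subseteq> (\<Union>i::nat. U i)\<rbrakk>
    \<Longrightarrow> c \<le> (\<Sum>i. ennreal (hausdorff_gauge d (U i)))"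
  shows "c \<le> hausdorff_premeasure d \<delta> A"
  unfolding hausdorff_premeasure_def using assms by (intro INF_greatest) auto

lemma hausdorff_premeasure_mono: "A \<subseteq> B \<Longrightarrow> hausdorff_premeasure d \<delta> A \<le> hausdorff_premeasure d \<delta> B"
  by (rule hausdorff_premeasure_greatest) (rule hausdorff_premeasure_le, auto)

lemma hausdorff_premeasure_antimono:
  "\<epsilon> \<le> \<delta> \<Longrightarrow> hausdorff_premeasure d \<delta> A \<le> hausdorff_premeasure d \<epsilon> A"
  by (rule hausdorff_premeasure_greatest) (rule hausdorff_premeasure_le, auto intro: order_trans)

lemma hausdorff_premeasure_empty: "0 \<le> \<delta> \<Longrightarrow> hausdorff_premeasure d \<delta> {} = 0"
  using hausdorff_premeasure_le[of "\<lambda>_. {}" \<delta> "{}" d] by (simp add: hausdorff_gauge_def)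

text \<open>Choose for each \<open>A n\<close> a cover that is optimal up to
  \<open>e / 2 ^ (n + 1)\<close> and enumerate all these covers together through
  \<open>prod_decode\<close>; the errors add up to \<open>e\<close>.\<close>

lemma hausdorff_premeasure_UN:
  "hausdorff_premeasure d \<delta> (\<Union>i::nat. A i) \<le> (\<Sum>i. hausdorff_premeasure d \<delta> (A i))"
proof (rule ennreal_le_epsilon)
  fix e :: real assume e: "0 < e" and fin: "(\<Sum>i. hausdorff_premeasure d \<delta> (A i)) < top"
  have "\<exists>U. (\<forall>i. bounded (U i) \<and> diameter (U i) \<le> \<delta>) \<and> A n \<subseteq> (\<Union>i::nat. U i) \<and>
      (\<Sum>i. ennreal (hausdorff_gauge d (U i)))
        \<le> hausdorff_premeasure d \<delta> (A n) + ennreal (e * (1/2) ^ Suc n)" for n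
  proof -
    have "hausdorff_premeasure d \<delta> (A n) < top"
      using fin by (metis ennreal_suminf_lessD)
    \<comment> \<open>Finiteness makes the added error a strict increase, so the infimum provides a
      cover below it.\<close>
    then have "hausdorff_premeasure d \<delta> (A n) < hausdorff_premeasure d \<delta> (A n) + ennreal (e * (1/2) ^ Suc n)"
      using e by (cases "hausdorff_premeasure d \<delta> (A n)")
        (auto simp: ennreal_plus[symmetric] ennreal_less_iff simp del: ennreal_plus)
    then show ?thesis
      unfolding hausdorff_premeasure_def[of d \<delta> "A n"] INF_less_iff by (auto intro: less_imp_le)
  qed
  then obtain U where U: "\<And>n i. bounded (U n i)" "\<And>n i. diameter (U n i) \<le> \<delta>"
      "\<And>n. A n \<subseteq> (\<Union>i::nat. U n i)"
      "\<And>n. (\<Sum>i. ennreal (hausdorff_gauge d (U n i)))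
        \<le> hausdorff_premeasure d \<delta> (A n) + ennreal (e * (1/2) ^ Suc n)"
    by metis
  define V where "V = (\<lambda>(m, n). U m n)"
  have "(\<Union>i. A i) \<subseteq> (\<Union>k. V (prod_decode k))"
  proof
    fix x assume "x \<in> (\<Union>i. A i)"
    then obtain m n where "x \<in> U m n" using U(3) by blast
    then have "x \<in> V (prod_decode (prod_encode (m, n)))" by (simp add: V_def)
    then show "x \<in> (\<Union>k. V (prod_decode k))" by blast
  qed
  then have "hausdorff_premeasure d \<delta> (\<Union>i. A i) \<le> (\<Sum>k. ennreal (hausdorff_gauge d (V (prod_decode k))))"
    by (intro hausdorff_premeasure_le) (auto simp: V_def U split: prod.split)
  also have "\<dots> = (\<Sum>m. \<Sum>n. ennreal (hausdorff_gauge d (U m n)))"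
    by (rule suminf_ennreal_2dimen) (simp add: V_def)
  also have "\<dots> \<le> (\<Sum>m. hausdorff_premeasure d \<delta> (A m) + ennreal (e * (1/2) ^ Suc m))"
    by (intro suminf_le U summableI)
  also have "\<dots> = (\<Sum>m. hausdorff_premeasure d \<delta> (A m)) + (\<Sum>m. ennreal (e * (1/2) ^ Suc m))"
    by (intro suminf_add[symmetric] summableI)
  also have "(\<Sum>m. ennreal (e * (1/2) ^ Suc m)) = ennreal e"
    using e sums_mult[OF power_half_series, of e] by (intro suminf_ennreal_eq) auto
  finally show "hausdorff_premeasure d \<delta> (\<Union>i. A i) \<le> (\<Sum>i. hausdorff_premeasure d \<delta> (A i)) + ennreal e" .
qed

lemma hausdorff_premeasure_le_outer:
  "0 < \<delta> \<Longrightarrow> hausdorff_premeasure d \<delta> A \<le> hausdorff_outer_measure d A"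
  unfolding hausdorff_outer_measure_def by (intro SUP_upper) auto

lemma outer_measure_space_hausdorff: "outer_measure_space UNIV (hausdorff_outer_measure d)"
  unfolding outer_measure_space_def positive_def increasing_def countably_subadditive_def
proof (intro conjI ballI impI allI)
  show "hausdorff_outer_measure d {} = 0"
    by (simp add: hausdorff_outer_measure_def hausdorff_premeasure_empty)
  show "hausdorff_outer_measure d A \<le> hausdorff_outer_measure d B" if "A \<subseteq> B" for A B :: "'a set"
    unfolding hausdorff_outer_measure_def using that
    by (intro SUP_mono bexI) (auto intro: hausdorff_premeasure_mono)
  show "hausdorff_outer_measure d (\<Union>i. A i) \<le> (\<Sum>i. hausdorff_outer_measure d (A i))"
    for A :: "nat \<Rightarrow> 'a set"
    unfolding hausdorff_outer_measure_def[of d "\<Union>i. A i"]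
  proof (rule SUP_least)
    fix \<delta> :: real assume "\<delta> \<in> {0<..}"
    then show "hausdorff_premeasure d \<delta> (\<Union>i. A i) \<le> (\<Sum>i. hausdorff_outer_measure d (A i))"
      by (intro order_trans[OF hausdorff_premeasure_UN] suminf_le summableI hausdorff_premeasure_le_outer) auto
  qed
qed

section \<open>Additivity on separated sets\<close>

text \<open>A covering set of diameter at most \<open>\<epsilon> < r\<close> cannot meet both
  \<open>A\<close> and \<open>B\<close>, so every cover of the union splits into a cover of
  \<open>A\<close> and a cover of \<open>B\<close>.\<close>

lemma hausdorff_premeasure_separated:
  assumes "\<epsilon> < r" and sep: "\<And>a b. a \<in> A \<Longrightarrow> b \<in> B \<Longrightarrow> r \<le> dist a b"
  shows "hausdorff_premeasure d \<epsilon> A + hausdorff_premeasure d \<epsilon> B \<le> hausdorff_premeasure d \<epsilon> (A \<union> B)"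
proof (rule hausdorff_premeasure_greatest)
  fix U :: "nat \<Rightarrow> 'a set"
  assume U: "\<And>i. bounded (U i)" "\<And>i. diameter (U i) \<le> \<epsilon>" "A \<union> B \<subseteq> (\<Union>i. U i)"
  define V where "V = (\<lambda>S i. if U i \<inter> S = {} then {} else U i)"
  \<comment> \<open>Discarded members become the empty set, whose diameter 0 must respect the bound
    \<open>\<epsilon>\<close>.\<close>
  have "0 \<le> \<epsilon>" using U(1,2)[of 0] diameter_ge_0 order_trans by blast
  have V: "hausdorff_premeasure d \<epsilon> S \<le> (\<Sum>i. ennreal (hausdorff_gauge d (V S i)))"
    if S: "S \<subseteq> A \<union> B" for S
    proof (rule hausdorff_premeasure_le)
    show "S \<subseteq> (\<Union>i. V S i)"
    proof
      fix x assume "x \<in> S"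
      then obtain i where "x \<in> U i" using U(3) S by blast
      then have "x \<in> V S i" using \<open>x \<in> S\<close> by (auto simp: V_def)
      then show "x \<in> (\<Union>i. V S i)" by blast
    qed
  qed (use U \<open>0 \<le> \<epsilon>\<close> in \<open>auto simp: V_def\<close>)
  have V_empty: "V A i = {} \<or> V B i = {}" for i
  proof (rule ccontr)
    assume "\<not> ?thesis"
    then obtain a b where "a \<in> U i" "a \<in> A" "b \<in> U i" "b \<in> B" by (auto simp: V_def split: if_splits)
    then show False
      using sep[of a b] diameter_bounded_bound[OF U(1), of a i b] U(2)[of i] \<open>\<epsilon> < r\<close> by simp
  qed
  \<comment> \<open>Each member is charged at most once. This relies on the empty set having gauge
    0, also for \<open>d = 0\<close>.\<close>
  have *: "ennreal (hausdorff_gauge d (V A i)) + ennreal (hausdorff_gauge d (V B i))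
      \<le> ennreal (hausdorff_gauge d (U i))" for i
    using V_empty[of i] by (auto simp: V_def hausdorff_gauge_def split: if_splits)
  have "hausdorff_premeasure d \<epsilon> A + hausdorff_premeasure d \<epsilon> B
      \<le> (\<Sum>i. ennreal (hausdorff_gauge d (V A i))) + (\<Sum>i. ennreal (hausdorff_gauge d (V B i)))"
    by (intro add_mono V) auto
  also have "\<dots> = (\<Sum>i. ennreal (hausdorff_gauge d (V A i)) + ennreal (hausdorff_gauge d (V B i)))"
    by (intro suminf_add summableI)
  also have "\<dots> \<le> (\<Sum>i. ennreal (hausdorff_gauge d (U i)))"
    by (intro suminf_le summableI *)
  finally show "hausdorff_premeasure d \<epsilon> A + hausdorff_premeasure d \<epsilon> B
    \<le> (\<Sum>i. ennreal (hausdorff_gauge d (U i)))" .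
qed

lemma hausdorff_outer_measure_separated:
  assumes "0 < r" and sep: "\<And>a b. a \<in> A \<Longrightarrow> b \<in> B \<Longrightarrow> r \<le> dist a b"
  shows "hausdorff_outer_measure d A + hausdorff_outer_measure d B \<le> hausdorff_outer_measure d (A \<union> B)"
proof -
  have "hausdorff_outer_measure d A + hausdorff_outer_measure d B
    = (SUP \<delta>\<in>{0<..}. hausdorff_premeasure d \<delta> A + hausdorff_premeasure d \<delta> B)"
    unfolding hausdorff_outer_measure_def
  \<comment> \<open>Both premeasures grow as \<open>\<delta>\<close> shrinks, so a common smaller
    scale dominates and the suprema may be added.\<close>
  proof (rule SUP_add_directed_ennreal[symmetric])
    fix i j :: real assume "i \<in> {0<..}" "j \<in> {0<..}"
    then show "\<exists>k\<in>{0<..}. hausdorff_premeasure d i A + hausdorff_premeasure d j B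
        \<le> hausdorff_premeasure d k A + hausdorff_premeasure d k B"
      by (intro bexI[of _ "min i j"] add_mono hausdorff_premeasure_antimono) auto
  qed
  also have "\<dots> \<le> hausdorff_outer_measure d (A \<union> B)"
  proof (rule SUP_least)
    fix \<delta> :: real assume \<delta>: "\<delta> \<in> {0<..}"
    \<comment> \<open>Pass to a scale below the separation \<open>r\<close>, which can only increase
      the premeasures.\<close>
    define \<epsilon> where "\<epsilon> = min \<delta> (r/2)"
    have \<epsilon>: "0 < \<epsilon>" "\<epsilon> \<le> \<delta>" "\<epsilon> < r" using \<delta> \<open>0 < r\<close> by (auto simp: \<epsilon>_def)
    have "hausdorff_premeasure d \<delta> A + hausdorff_premeasure d \<delta> B
        \<le> hausdorff_premeasure d \<epsilon> A + hausdorff_premeasure d \<epsilon> B"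
      by (intro add_mono hausdorff_premeasure_antimono \<epsilon>)
    also have "\<dots> \<le> hausdorff_premeasure d \<epsilon> (A \<union> B)"
      using \<epsilon>(3) sep by (rule hausdorff_premeasure_separated)
    also have "\<dots> \<le> hausdorff_outer_measure d (A \<union> B)"
      by (rule hausdorff_premeasure_le_outer[OF \<epsilon>(1)])
    finally show "hausdorff_premeasure d \<delta> A + hausdorff_premeasure d \<delta> B \<le> hausdorff_outer_measure d (A \<union> B)" .
  qed
  finally show ?thesis .
qed

section \<open>Closed sets are Caratheodory measurable\<close>

text \<open>The library's subadditivity speaks of disjoint sets only, so it is applied to
  \<open>A\<close> and \<open>B - A\<close>.\<close>

lemma outer_measure_space_Un:
  assumes "outer_measure_space UNIV \<mu>"
  shows "\<mu> (A \<union> B) \<le> \<mu> A + \<mu> B"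
proof -
  have "subadditive UNIV \<mu>"
    using assms ring_of_sets.countably_subadditive_subadditive[OF ring_of_sets_Pow, of UNIV \<mu>]
    by (simp add: outer_measure_space_def)
  then have "\<mu> (A \<union> (B - A)) \<le> \<mu> A + \<mu> (B - A)"
    unfolding subadditive_def by (metis Diff_disjoint UNIV_I)
  also have "\<mu> (B - A) \<le> \<mu> B"
    using assms by (simp add: outer_measure_space_def increasing_def Diff_subset)
  finally show ?thesis by simp
qed

text \<open>Caratheodory's criterion. The points at distance at least \<open>1 / (n + 1)\<close> from \<open>F\<close> exhaust
  \<open>X - F\<close>; the annuli between consecutive levels have finite total measure because those of equal
  parity are pairwise separated.\<close>

lemma closed_in_lambda_system_metric:
  fixes \<mu> :: "'a::metric_space set \<Rightarrow> ennreal"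
  assumes oms: "outer_measure_space UNIV \<mu>"
    and sep: "\<And>r A B. \<lbrakk>0 < r; \<And>a b. a \<in> A \<Longrightarrow> b \<in> B \<Longrightarrow> r \<le> dist a b\<rbrakk> \<Longrightarrow> \<mu> A + \<mu> B \<le> \<mu> (A \<union> B)"
    and "closed F"
  shows "F \<in> lambda_system UNIV UNIV \<mu>"
proof (cases "F = {}")
  case True
  have "\<mu> {} = 0" using oms by (simp add: outer_measure_space_def positive_def)
  then show ?thesis using True by (simp add: lambda_system_def)
next
  case False
  have mono: "A \<subseteq> B \<Longrightarrow> \<mu> A \<le> \<mu> B" for A B
    using oms by (simp add: outer_measure_space_def increasing_def)
  have csub: "\<mu> (\<Union>i. A i) \<le> (\<Sum>i. \<mu> (A i))" if "disjoint_family A" for A :: "nat \<Rightarrow> 'a set"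
    using oms that by (simp add: outer_measure_space_def countably_subadditive_def)
  have main: "\<mu> (X \<inter> F) + \<mu> (X - F) \<le> \<mu> X" if fin: "\<mu> X < top" for X
  proof -
    define E where "E n = {x\<in>X. 1 / real (Suc n) \<le> infdist x F}" for n
    define D where "D n = E (Suc n) - E n" for n
    have E_mono: "E m \<subseteq> E n" if "m \<le> n" for m n
    proof -
      have "1 / real (Suc n) \<le> 1 / real (Suc m)" using that by (simp add: field_simps)
      then show ?thesis by (auto simp: E_def)
    qed
    have DE: "D m \<subseteq> E n" if "m < n" for m n using E_mono[of "Suc m" n] that by (auto simp: D_def)
    have disjD: "disjoint_family (\<lambda>k. D (k + n))" for n
      unfolding disjoint_family_on_def
    proof (intro ballI impI)
      fix i j :: nat assume "i \<noteq> j"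
      then show "D (i + n) \<inter> D (j + n) = {}"
        using DE[of "i + n" "j + n"] DE[of "j + n" "i + n"] by (cases "i < j") (auto simp: D_def)
    qed
    \<comment> \<open>The distance to \<open>F\<close> is 1-Lipschitz, so a point of
      \<open>E n\<close> stays away from the points of \<open>X\<close> outside the next
      level.\<close>
    have gap: "1 / real (Suc n) - 1 / real (Suc (Suc n)) \<le> dist a b"
      if "a \<in> E n" "b \<notin> E (Suc n)" "b \<in> X" for a b n
    proof -
      have "infdist a F \<le> infdist b F + dist a b" by (rule infdist_triangle)
      then show ?thesis using that unfolding E_def by auto
    qed
    have gap_pos: "0 < 1 / real (Suc n) - 1 / real (Suc (Suc n))" for n
      by (simp add: frac_less2)
    \<comment> \<open>\<open>p\<close> selects the parity. With \<open>m = l + 1\<close>, the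
      earlier annuli lie in \<open>E (2 * l + 1 + p)\<close>, while the new one avoids
      \<open>E (2 * l + 2 + p)\<close>; the skipped annulus provides the gap.\<close>
    have alt: "(\<Sum>k<m. \<mu> (D (2 * k + p))) \<le> \<mu> X" for m p
    proof -
      have "(\<Sum>k<m. \<mu> (D (2 * k + p))) \<le> \<mu> (\<Union>k<m. D (2 * k + p))"
      proof (induction m)
        case (Suc m)
        have "(\<Sum>k<Suc m. \<mu> (D (2 * k + p))) \<le> \<mu> (\<Union>k<m. D (2 * k + p)) + \<mu> (D (2 * m + p))"
          using Suc by (simp add: add_right_mono)
        also have "\<dots> \<le> \<mu> ((\<Union>k<m. D (2 * k + p)) \<union> D (2 * m + p))"
        proof (cases m)
          case (Suc l)
          have "(\<Union>k<m. D (2 * k + p)) \<subseteq> E (2 * l + 1 + p)"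
          proof
            fix x assume "x \<in> (\<Union>k<m. D (2 * k + p))"
            then obtain k where "k \<le> l" "x \<in> D (2 * k + p)" using Suc by (auto simp: less_Suc_eq_le)
            then show "x \<in> E (2 * l + 1 + p)" using DE[of "2 * k + p" "2 * l + 1 + p"] by auto
          qed
          moreover have "b \<notin> E (Suc (2 * l + 1 + p))" "b \<in> X" if "b \<in> D (2 * m + p)" for b
            using that Suc by (auto simp: D_def E_def)
          ultimately show ?thesis
            by (intro sep[OF gap_pos[of "2 * l + 1 + p"]] gap) auto
        qed (use oms in \<open>simp add: outer_measure_space_def positive_def\<close>)
        also have "\<dots> = \<mu> (\<Union>k<Suc m. D (2 * k + p))" by (simp add: lessThan_Suc Un_commute)
        finally show ?case .
      qed simp
      also have "\<dots> \<le> \<mu> X" by (intro mono) (auto simp: D_def E_def)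
      finally show ?thesis .
    qed
    have sumD: "(\<Sum>k<n. \<mu> (D k)) \<le> \<mu> X + \<mu> X" for n
    proof -
      have "(\<Sum>k<n. \<mu> (D k)) \<le> (\<Sum>k<2 * n. \<mu> (D k))" by (rule sum_mono2) auto
      also have "\<dots> = (\<Sum>k<n. \<mu> (D (2 * k))) + (\<Sum>k<n. \<mu> (D (2 * k + 1)))"
        by (induction n) (auto simp: ac_simps)
      also have "\<dots> \<le> \<mu> X + \<mu> X" using alt[of 0 n] alt[of 1 n] by (auto intro: add_mono)
      finally show ?thesis .
    qed
    then have "(\<Sum>k. \<mu> (D k)) \<le> \<mu> X + \<mu> X" by (simp add: suminf_eq_SUP SUP_least)
    then have finD: "(\<Sum>k. \<mu> (D k)) \<noteq> top"
      using fin by (metis ennreal_add_eq_top less_top top.extremum_uniqueI)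
    have "\<mu> (D k) < top" for k
      using finD by (metis ennreal_suminf_lessD less_top)
    then have D_real: "\<mu> (D k) = ennreal (enn2real (\<mu> (D k)))" for k by simp
    have "summable (\<lambda>k. enn2real (\<mu> (D k)))"
      using finD D_real by (intro summable_suminf_not_top) auto
    note tail = suminf_exist_split2[OF this] and summ = summable_ignore_initial_segment[OF this]
    show ?thesis
    proof (rule ennreal_le_epsilon)
      fix e :: real assume "0 < e"
      \<comment> \<open>The annuli have finite total measure, so those from some level on contribute
        less than \<open>e\<close>.\<close>
      then obtain n where "(\<Sum>k. enn2real (\<mu> (D (k + n)))) < e"
        using order_tendstoD(2)[OF tail, of e] by (auto simp: eventually_sequentially)
      then have small: "(\<Sum>k. \<mu> (D (k + n))) \<le> ennreal e"
        by (subst D_real, subst suminf_ennreal2) (auto intro!: ennreal_leI summ)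
      \<comment> \<open>A point off the closed set \<open>F\<close> has positive distance to it and
        hence enters some level. If its first level \<open>m\<close> exceeds \<open>n\<close>, it
        lies in \<open>D (m - 1)\<close>.\<close>
      have "X - F \<subseteq> E n \<union> (\<Union>k. D (k + n))"
      proof
        fix x assume x: "x \<in> X - F"
        then have "infdist x F > 0"
          using False \<open>closed F\<close> by (simp add: infdist_pos_not_in_closed)
        then obtain N where "inverse (real (Suc N)) < infdist x F" using reals_Archimedean by blast
        then have N: "x \<in> E N" using x by (auto simp: E_def inverse_eq_divide)
        define m where "m = (LEAST m. x \<in> E m)"
        have m: "x \<in> E m" unfolding m_def using N by (rule LeastI)
        show "x \<in> E n \<union> (\<Union>k. D (k + n))"
        proof (cases "m \<le> n")
          case False
          then obtain l where l: "m = Suc l" by (cases m) auto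
          then have "x \<in> D ((l - n) + n)"
            using m not_less_Least[of l "\<lambda>m. x \<in> E m"] False by (auto simp: D_def m_def[symmetric])
          then show ?thesis by blast
        qed (use m E_mono in blast)
      qed
      then have "\<mu> (X - F) \<le> \<mu> (E n \<union> (\<Union>k. D (k + n)))" by (rule mono)
      also have "\<dots> \<le> \<mu> (E n) + \<mu> (\<Union>k. D (k + n))" by (rule outer_measure_space_Un[OF oms])
      also have "\<mu> (\<Union>k. D (k + n)) \<le> ennreal e" using csub[OF disjD] small by (rule order_trans)
      finally have 1: "\<mu> (X - F) \<le> \<mu> (E n) + ennreal e" by simp
      \<comment> \<open>\<open>E n\<close> keeps distance \<open>1 / (n + 1)\<close> from
        \<open>F\<close>, so the separation hypothesis applies.\<close>
      have "\<mu> (X \<inter> F) + \<mu> (E n) \<le> \<mu> (X \<inter> F \<union> E n)"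
      proof (rule sep)
        show "1 / real (Suc n) \<le> dist a b" if "a \<in> X \<inter> F" "b \<in> E n" for a b
          using that infdist_le[of a F b] by (auto simp: E_def dist_commute)
      qed simp
      also have "\<dots> \<le> \<mu> X" by (rule mono) (auto simp: E_def)
      finally have 2: "\<mu> (X \<inter> F) + \<mu> (E n) \<le> \<mu> X" .
      have "\<mu> (X \<inter> F) + \<mu> (X - F) \<le> \<mu> (X \<inter> F) + (\<mu> (E n) + ennreal e)"
        using 1 by (rule add_left_mono)
      also have "\<dots> \<le> \<mu> X + ennreal e" using 2 by (simp add: add.assoc[symmetric] add_right_mono)
      finally show "\<mu> (X \<inter> F) + \<mu> (X - F) \<le> \<mu> X + ennreal e" .
    qed
  qed
  have "\<mu> (F \<inter> X) + \<mu> ((UNIV - F) \<inter> X) = \<mu> X" for X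
  proof (rule antisym)
    have "(UNIV - F) \<inter> X = X - F" by auto
    then show "\<mu> (F \<inter> X) + \<mu> ((UNIV - F) \<inter> X) \<le> \<mu> X"
      using main[of X] by (cases "\<mu> X = top") (auto simp: Int_commute less_top)
    have "X = F \<inter> X \<union> (UNIV - F) \<inter> X" by auto
    then show "\<mu> X \<le> \<mu> (F \<inter> X) + \<mu> ((UNIV - F) \<inter> X)"
      using outer_measure_space_Un[OF oms, of "F \<inter> X" "(UNIV - F) \<inter> X"] by simp
  qed
  then show ?thesis by (simp add: lambda_system_def)
qed

section \<open>The Hausdorff measure and its Borel sets\<close>

lemma space_hausdorff_measure [simp]: "space (hausdorff_measure d) = UNIV"
  by (simp add: hausdorff_measure_def space_measure_of_conv)

text \<open>Caratheodory's theorem. It ensures that \<open>measure_of\<close> keeps the outer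
  measure on these sets instead of defaulting to zero.\<close>

lemma measure_space_hausdorff:
  "measure_space UNIV (lambda_system UNIV UNIV (hausdorff_outer_measure d)) (hausdorff_outer_measure d)"
  using sigma_algebra.caratheodory_lemma[of UNIV UNIV] sigma_algebra_Pow[of UNIV]
    outer_measure_space_hausdorff by auto

lemma sets_hausdorff_measure:
  "sets (hausdorff_measure d) = lambda_system UNIV UNIV (hausdorff_outer_measure d)"
  using measure_space_hausdorff unfolding hausdorff_measure_def
  by (subst sets_measure_of) (auto simp: measure_space_def intro!: sigma_algebra.sigma_sets_eq)

lemma emeasure_hausdorff_measure:
  assumes "A \<in> sets (hausdorff_measure d)"
  shows "emeasure (hausdorff_measure d) A = hausdorff_outer_measure d A"
  using assms measure_space_hausdorff[of d] unfolding sets_hausdorff_measure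
  unfolding hausdorff_measure_def
  by (intro emeasure_measure_of_sigma) (auto simp: measure_space_def)

lemma sets_borel_subset_hausdorff: "sets borel \<subseteq> sets (hausdorff_measure d)"
proof -
  interpret sigma_algebra UNIV "sets (hausdorff_measure d :: 'a measure)"
    using sets.sigma_algebra_axioms[of "hausdorff_measure d :: 'a measure"] by simp
  have "{S::'a set. closed S} \<subseteq> sets (hausdorff_measure d)"
    unfolding sets_hausdorff_measure
    by (auto intro!: closed_in_lambda_system_metric outer_measure_space_hausdorff
        hausdorff_outer_measure_separated)
  then show ?thesis
    by (simp add: borel_eq_closed sigma_sets_subset)
qed

subsection \<open>Surface measure of convex bodies\<close>

text \<open>For \<open>\<eta>\<close> slightly above the diameter, the swept set is covered by about
  \<open>1 / \<eta>\<close> balls of radius \<open>\<eta> * (1 + norm v)\<close> centred on the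
  segment from a point of \<open>U\<close> in direction \<open>v\<close>. Each has volume of order
  \<open>\<eta> ^ n\<close> with \<open>n = DIM('a)\<close>, which leaves
  \<open>\<eta> ^ (n - 1)\<close>.\<close>

lemma emeasure_cylinder_le:
  fixes U :: "'a::euclidean_space set" and v :: 'a
  assumes "bounded U" "diameter U \<le> 1"
  shows "emeasure lborel ((\<lambda>(a, t). a + t *\<^sub>R v) ` (U \<times> {0..1}))
    \<le> ennreal (5 * unit_ball_vol (real DIM('a)) * (1 + norm v) ^ DIM('a) * diameter U ^ (DIM('a) - 1))"
proof (cases "U = {}")
  case False
  then obtain a where "a \<in> U" by blast
  let ?C = "5 * unit_ball_vol (real DIM('a)) * (1 + norm v) ^ DIM('a)"
  let ?Z = "(\<lambda>(a, t). a + t *\<^sub>R v) ` (U \<times> {0..1::real})"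
  \<comment> \<open>A strictly larger \<open>\<eta>\<close> keeps \<open>1 / \<eta>\<close>
    meaningful when the diameter is 0. The bound \<open>\<eta> < 2\<close> produces the factor 5,
    through \<open>\<eta> * (N + 1) \<le> 1 + 2 * \<eta>\<close>.\<close>
  have *: "emeasure lborel ?Z \<le> ennreal (?C * \<eta> ^ (DIM('a) - 1))"
    if \<eta>: "diameter U < \<eta>" "\<eta> < 2" for \<eta>
  proof -
    have "0 < \<eta>" using \<eta>(1) diameter_ge_0[OF \<open>bounded U\<close>] by linarith
    define N where "N = nat \<lceil>1 / \<eta>\<rceil>"
    have N: "1 / \<eta> \<le> N" "N \<le> 1 / \<eta> + 1" using \<open>0 < \<eta>\<close> by (auto simp: N_def)
    then have "0 < N" using \<open>0 < \<eta>\<close> by (cases N) (auto simp: field_simps)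
    have N': "1 / N \<le> \<eta>" using N(1) \<open>0 < \<eta>\<close> \<open>0 < N\<close> by (simp add: field_simps)
    define c where "c k = a + (real k / N) *\<^sub>R v" for k
    have "?Z \<subseteq> (\<Union>k\<le>N. cball (c k) (\<eta> * (1 + norm v)))"
    proof clarify
      fix b :: 'a and t :: real assume b: "b \<in> U" and t: "t \<in> {0..1}"
      \<comment> \<open>\<open>k / N\<close> is the grid point just below \<open>t\<close>, at
        distance at most \<open>1 / N \<le> \<eta>\<close>.\<close>
      define k where "k = nat \<lfloor>t * N\<rfloor>"
      have k: "k \<le> t * N" "t * N < real k + 1"
        using t floor_correct[of "t * N"] by (auto simp: k_def)
      have "t * real N \<le> real N" using t by (simp add: mult_left_le_one_le)
      then have "k \<le> N" using k(1) by simp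
      have "real k / N \<le> t" "t \<le> real k / N + 1 / N"
        using k \<open>0 < N\<close> by (auto simp: field_simps)
      then have "\<bar>t - real k / N\<bar> \<le> \<eta>" using N' by linarith
      moreover have "norm (b - a) \<le> \<eta>"
        using diameter_bounded_bound[OF \<open>bounded U\<close> b \<open>a \<in> U\<close>] \<eta>(1) by (simp add: dist_norm)
      ultimately have "norm ((b - a) + (t - real k / N) *\<^sub>R v) \<le> \<eta> + \<eta> * norm v"
        by (intro order_trans[OF norm_triangle_ineq] add_mono) (auto intro: mult_right_mono)
      also have "(b - a) + (t - real k / N) *\<^sub>R v = (b + t *\<^sub>R v) - c k"
        by (simp add: c_def algebra_simps)
      finally have "b + t *\<^sub>R v \<in> cball (c k) (\<eta> * (1 + norm v))"
        by (simp add: dist_norm norm_minus_commute algebra_simps)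
      then show "b + t *\<^sub>R v \<in> (\<Union>k\<le>N. cball (c k) (\<eta> * (1 + norm v)))"
        using \<open>k \<le> N\<close> by blast
    qed
    then have "emeasure lborel ?Z \<le> emeasure lborel (\<Union>k\<le>N. cball (c k) (\<eta> * (1 + norm v)))"
      by (rule emeasure_mono) auto
    also have "\<dots> \<le> (\<Sum>k\<le>N. emeasure lborel (cball (c k) (\<eta> * (1 + norm v))))"
      by (rule emeasure_subadditive_finite) auto
    also have "\<dots> = ennreal ((N + 1) * (unit_ball_vol (real DIM('a)) * (\<eta> * (1 + norm v)) ^ DIM('a)))"
    proof -
      have "0 \<le> \<eta> * (1 + norm v)" using \<open>0 < \<eta>\<close> by simp
      then have "(\<Sum>k\<le>N. emeasure lborel (cball (c k) (\<eta> * (1 + norm v))))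
          = ennreal (real (N + 1)) * ennreal (unit_ball_vol (real DIM('a)) * (\<eta> * (1 + norm v)) ^ DIM('a))"
        by (simp only: emeasure_cball sum_constant card_atMost ennreal_of_nat_eq_real_of_nat Suc_eq_plus1)
      then show ?thesis by (simp only: ennreal_mult'[symmetric] of_nat_0_le_iff)
    qed
    also have "\<dots> \<le> ennreal (?C * \<eta> ^ (DIM('a) - 1))"
    proof (rule ennreal_leI)
      have "\<eta> * (real N + 1) \<le> 5"
      proof -
        have "\<eta> * (real N + 1) \<le> \<eta> * (1 / \<eta> + 2)" using N(2) \<open>0 < \<eta>\<close> by (intro mult_left_mono) auto
        also have "\<dots> = 1 + 2 * \<eta>" using \<open>0 < \<eta>\<close> by (simp add: field_simps)
        finally show ?thesis using \<eta>(2) by linarith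
      qed
      moreover have "\<eta> ^ DIM('a) = \<eta> * \<eta> ^ (DIM('a) - 1)"
        by (metis DIM_positive power_eq_if less_numeral_extra(3))
      ultimately have "(real N + 1) * \<eta> ^ DIM('a) \<le> 5 * \<eta> ^ (DIM('a) - 1)"
        using mult_right_mono[of "\<eta> * (real N + 1)" 5 "\<eta> ^ (DIM('a) - 1)"] \<open>0 < \<eta>\<close>
        by (simp add: ac_simps)
      then have "(real N + 1) * \<eta> ^ DIM('a) * (unit_ball_vol (real DIM('a)) * (1 + norm v) ^ DIM('a))
          \<le> 5 * \<eta> ^ (DIM('a) - 1) * (unit_ball_vol (real DIM('a)) * (1 + norm v) ^ DIM('a))"
        by (rule mult_right_mono) auto
      then show "(N + 1) * (unit_ball_vol (real DIM('a)) * (\<eta> * (1 + norm v)) ^ DIM('a))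
          \<le> ?C * \<eta> ^ (DIM('a) - 1)"
        by (simp add: power_mult_distrib ac_simps)
    qed
    finally show ?thesis .
  qed
  show ?thesis
  \<comment> \<open>Let \<open>\<eta>\<close> decrease to the diameter.\<close>
  proof (rule tendsto_lowerbound)
    show "((\<lambda>\<eta>. ennreal (?C * \<eta> ^ (DIM('a) - 1))) \<longlongrightarrow> ennreal (?C * diameter U ^ (DIM('a) - 1)))
        (at_right (diameter U))"
      by (intro tendsto_ennrealI tendsto_intros)
    show "\<forall>\<^sub>F \<eta> in at_right (diameter U). emeasure lborel ?Z \<le> ennreal (?C * \<eta> ^ (DIM('a) - 1))"
      by (rule eventually_mono[OF eventually_at_right_real[of "diameter U" 2]]) (use assms * in auto)
  qed simp
qed simp

text \<open>The sets swept out by the members of any cover of \<open>S\<close> together contain the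
  ball. Each has volume at most a constant times its gauge, so the gauges cannot sum to less than a
  fixed positive number.\<close>

lemma hausdorff_outer_measure_pos_if_ball_subset_cylinder:
  fixes S :: "'a::euclidean_space set"
  assumes "0 < \<epsilon>" and ball: "ball z \<epsilon> \<subseteq> (\<lambda>(a, t). a + t *\<^sub>R v) ` (S \<times> {0..1})"
  shows "0 < hausdorff_outer_measure (DIM('a) - 1) S"
proof -
  let ?d = "DIM('a) - 1"
  \<comment> \<open>The last two factors convert \<open>diameter U ^ ?d\<close> into the gauge of
    \<open>U\<close>.\<close>
  define c where "c = 5 * unit_ball_vol (real DIM('a)) * (1 + norm v) ^ DIM('a) * 2 ^ ?d / unit_ball_vol (real ?d)"
  have "0 < 1 + norm v" by (simp add: add_pos_nonneg)
  then have "0 < c" by (auto simp: c_def)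
  \<comment> \<open>Taking the closure preserves the diameter and makes \<open>Z U\<close> compact
    for bounded \<open>U\<close>, hence measurable.\<close>
  define Z where "Z U = (\<lambda>(a, t). a + t *\<^sub>R v) ` (closure U \<times> {0..1::real})" for U
  have Z_le: "emeasure lborel (Z U) \<le> ennreal c * ennreal (hausdorff_gauge ?d U)"
    if "bounded U" "diameter U \<le> 1" for U
  proof (cases "U = {}")
    case False
    have "emeasure lborel (Z U)
        \<le> ennreal (5 * unit_ball_vol (real DIM('a)) * (1 + norm v) ^ DIM('a) * diameter U ^ ?d)"
      using emeasure_cylinder_le[of "closure U" v] that
      by (simp add: Z_def diameter_closure bounded_closure)
    also have "\<dots> = ennreal (c * hausdorff_gauge ?d U)"
      using False less_imp_neq[OF unit_ball_vol_pos[of "real ?d"]]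
      unfolding c_def hausdorff_gauge_def by (simp add: power_divide ac_simps del: of_nat_diff)
    finally show ?thesis using \<open>0 < c\<close> by (simp add: ennreal_mult')
  qed (simp add: Z_def)
  \<comment> \<open>The scale 1 is enough, since the outer measure is the supremum over all
    scales.\<close>
  have "ennreal (1 / c) * emeasure lborel (ball z \<epsilon>) \<le> hausdorff_premeasure ?d 1 S"
  proof (rule hausdorff_premeasure_greatest)
    fix U :: "nat \<Rightarrow> 'a set"
    assume U: "\<And>i. bounded (U i)" "\<And>i. diameter (U i) \<le> 1" "S \<subseteq> (\<Union>i. U i)"
    have Z_meas: "Z (U i) \<in> sets lborel" for i
    proof -
      have "compact (closure (U i) \<times> {0..1::real})"
        using U(1) by (intro compact_Times) (auto simp: compact_closure)
      then have "compact (Z (U i))"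
        unfolding Z_def
        by (intro compact_continuous_image) (auto simp: case_prod_unfold intro!: continuous_intros)
      then show ?thesis by (simp add: borel_compact)
    qed
    have "ball z \<epsilon> \<subseteq> (\<Union>i. Z (U i))"
    proof
      fix q assume "q \<in> ball z \<epsilon>"
      then obtain a t where "a \<in> S" "t \<in> {0..1}" "q = a + t *\<^sub>R v" using ball by auto
      moreover obtain i where "a \<in> U i" using U(3) \<open>a \<in> S\<close> by blast
      ultimately have "q \<in> Z (U i)" using closure_subset by (force simp: Z_def)
      then show "q \<in> (\<Union>i. Z (U i))" by blast
    qed
    then have "emeasure lborel (ball z \<epsilon>) \<le> emeasure lborel (\<Union>i. Z (U i))"
      using Z_meas by (intro emeasure_mono) auto
    also have "\<dots> \<le> (\<Sum>i. emeasure lborel (Z (U i)))"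
      using Z_meas by (intro emeasure_subadditive_countably) auto
    also have "\<dots> \<le> (\<Sum>i. ennreal c * ennreal (hausdorff_gauge ?d (U i)))"
      by (intro suminf_le summableI Z_le U)
    finally have "emeasure lborel (ball z \<epsilon>) \<le> ennreal c * (\<Sum>i. ennreal (hausdorff_gauge ?d (U i)))"
      by simp
    then have "ennreal (1 / c) * emeasure lborel (ball z \<epsilon>)
        \<le> ennreal (1 / c) * (ennreal c * (\<Sum>i. ennreal (hausdorff_gauge ?d (U i))))"
      by (rule mult_left_mono) simp
    also have "\<dots> = (\<Sum>i. ennreal (hausdorff_gauge ?d (U i)))"
      using \<open>0 < c\<close> by (simp add: mult.assoc[symmetric] ennreal_mult[symmetric])
    finally show "ennreal (1 / c) * emeasure lborel (ball z \<epsilon>)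
        \<le> (\<Sum>i. ennreal (hausdorff_gauge ?d (U i)))" .
  qed
  moreover have "0 < ennreal (1 / c) * emeasure lborel (ball z \<epsilon>)"
    using \<open>0 < c\<close> \<open>0 < \<epsilon>\<close> by (simp add: emeasure_ball ennreal_zero_less_mult_iff)
  ultimately show ?thesis
    using hausdorff_premeasure_le_outer[of 1 ?d S] by (meson less_le_trans zero_less_one)
qed

section \<open>Positive surface measure of frontier pieces\<close>

text \<open>For a short \<open>v\<close> pointing from \<open>y\<close> to an interior point,
  \<open>y + v\<close> is interior and \<open>y - v\<close> lies outside \<open>K\<close>. Segments
  in direction \<open>- 2 *\<^sub>R v\<close> starting near \<open>y + v\<close> therefore cross the
  frontier, and they do so close to \<open>y\<close>.\<close>

lemma frontier_cylinder_contains_ball: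
  fixes K :: "'a::euclidean_space set"
  assumes "closed K" "convex K" "interior K \<noteq> {}" "y \<in> frontier K" "0 < \<rho>"
  obtains v z \<epsilon> where "0 < \<epsilon>"
    "ball z \<epsilon> \<subseteq> (\<lambda>(a, t). a + t *\<^sub>R v) ` ((frontier K \<inter> ball y \<rho>) \<times> {0..1})"
proof -
  obtain p where p: "p \<in> interior K" using assms(3) by blast
  have y: "y \<in> closure K" "y \<notin> interior K" using assms(4) by (auto simp: frontier_def)
  then have "p \<noteq> y" using p by blast
  \<comment> \<open>\<open>c \<le> 1\<close> keeps \<open>y + v\<close> on the segment from
    \<open>y\<close> to \<open>p\<close>; the other bound gives
    \<open>norm v \<le> \<rho> / 4\<close>.\<close>
  define c where "c = min 1 (\<rho> / (4 * norm (p - y)))"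
  have c: "0 < c" "c \<le> 1" using \<open>0 < \<rho>\<close> \<open>p \<noteq> y\<close> by (auto simp: c_def)
  define v where "v = c *\<^sub>R (p - y)"
  have "c * norm (p - y) \<le> \<rho> / (4 * norm (p - y)) * norm (p - y)"
    by (intro mult_right_mono) (auto simp: c_def)
  then have norm_v: "norm v < \<rho> / 2"
    using \<open>p \<noteq> y\<close> \<open>0 < \<rho>\<close> c by (simp add: v_def)
  have in1: "y + v \<in> interior K"
    using mem_interior_closure_convex_shrink[OF \<open>convex K\<close> p y(1) c] by (simp add: v_def algebra_simps)
  \<comment> \<open>Otherwise \<open>y\<close>, the midpoint of \<open>y - v\<close> and the
    interior point \<open>y + v\<close>, would itself be interior.\<close>
  have out: "y - v \<notin> K"
  proof
    assume "y - v \<in> K"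
    from mem_interior_convex_shrink[OF \<open>convex K\<close> in1 this, of "1/2"]
    have "y \<in> interior K" by (simp add: algebra_simps scaleR_2[symmetric])
    then show False using y by blast
  qed
  obtain e1 where e1: "0 < e1" "ball (y + v) e1 \<subseteq> K"
    using in1 by (auto simp: mem_interior)
  obtain e2 where e2: "0 < e2" "ball (y - v) e2 \<subseteq> - K"
    using out \<open>closed K\<close> openE[of "- K" "y - v"] by (auto simp: open_Compl)
  define \<epsilon> where "\<epsilon> = min (min e1 e2) (\<rho> / 2)"
  have "ball (y + v) \<epsilon> \<subseteq> (\<lambda>(a, t). a + t *\<^sub>R (2 *\<^sub>R v)) ` ((frontier K \<inter> ball y \<rho>) \<times> {0..1})"
  proof
    fix q assume q: "q \<in> ball (y + v) \<epsilon>"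
    have "q \<in> K" using q e1 by (auto simp: \<epsilon>_def)
    moreover have "q - 2 *\<^sub>R v \<in> ball (y - v) e2"
    proof -
      have "dist (y - v) (q - 2 *\<^sub>R v) = dist (y + v) q"
        by (simp add: dist_norm scaleR_2 algebra_simps)
      then show ?thesis using q by (simp add: \<epsilon>_def)
    qed
    then have "q - 2 *\<^sub>R v \<notin> K" using e2 by auto
    ultimately have "closed_segment q (q - 2 *\<^sub>R v) \<inter> frontier K \<noteq> {}"
      by (intro connected_Int_frontier) auto
    then obtain b where b: "b \<in> frontier K" "b \<in> closed_segment q (q - 2 *\<^sub>R v)" by blast
    then obtain u where u: "0 \<le> u" "u \<le> 1" "b = (1 - u) *\<^sub>R q + u *\<^sub>R (q - 2 *\<^sub>R v)"
      by (auto simp: in_segment)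
    have qb: "q = b + u *\<^sub>R (2 *\<^sub>R v)" using u(3) by (simp add: algebra_simps)
    \<comment> \<open>The crossing point differs from \<open>y\<close> by less than
      \<open>\<epsilon> \<le> \<rho> / 2\<close> plus at most
      \<open>norm v < \<rho> / 2\<close>.\<close>
    have "b - y = (q - (y + v)) + (1 - 2 * u) *\<^sub>R v" using u(3) by (simp add: algebra_simps)
    then have "norm (b - y) \<le> norm (q - (y + v)) + \<bar>1 - 2 * u\<bar> * norm v"
      by (metis norm_scaleR norm_triangle_ineq)
    also have "\<bar>1 - 2 * u\<bar> * norm v \<le> 1 * norm v" using u by (intro mult_right_mono) auto
    also have "norm (q - (y + v)) + 1 * norm v < \<rho>"
      using q norm_v by (simp add: \<epsilon>_def dist_norm norm_minus_commute)
    finally have "b \<in> ball y \<rho>" by (simp add: dist_norm norm_minus_commute)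
    then show "q \<in> (\<lambda>(a, t). a + t *\<^sub>R (2 *\<^sub>R v)) ` ((frontier K \<inter> ball y \<rho>) \<times> {0..1})"
      using b(1) u(1,2) qb by (intro image_eqI[of _ _ "(b, u)"]) auto
  qed
  moreover have "0 < \<epsilon>" using e1 e2 \<open>0 < \<rho>\<close> by (simp add: \<epsilon>_def)
  ultimately show thesis using that by blast
qed

lemma space_surface_measure [simp]: "space (surface_measure K) = frontier K"
  by (simp add: surface_measure_def space_restrict_space)

lemma frontier_in_sets_hausdorff: "frontier K \<inter> space (hausdorff_measure d) \<in> sets (hausdorff_measure d)"
  using subsetD[OF sets_borel_subset_hausdorff, of "frontier K" d] by (simp add: borel_closed)

lemma frontier_Int_borel_in_sets_surface_measure:
  "A \<in> sets borel \<Longrightarrow> frontier K \<inter> A \<in> sets (surface_measure K)"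
  unfolding surface_measure_def sets_restrict_space using sets_borel_subset_hausdorff by blast

lemma emeasure_surface_measure_ball_pos:
  fixes K :: "'a::euclidean_space set"
  assumes "convex_body K" "y \<in> frontier K" "0 < \<rho>"
  shows "0 < emeasure (surface_measure K) (frontier K \<inter> ball y \<rho>)"
proof -
  have "closed K" "convex K" "interior K \<noteq> {}"
    using assms(1) by (auto simp: convex_body_def compact_imp_closed)
  from frontier_cylinder_contains_ball[OF this assms(2,3)]
  have "0 < hausdorff_outer_measure (DIM('a) - 1) (frontier K \<inter> ball y \<rho>)"
    by (metis hausdorff_outer_measure_pos_if_ball_subset_cylinder)
  moreover have "frontier K \<inter> ball y \<rho> \<in> sets (hausdorff_measure (DIM('a) - 1))"
    by (rule subsetD[OF sets_borel_subset_hausdorff]) (simp add: borel_closed)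
  ultimately show ?thesis
    unfolding surface_measure_def
    by (simp add: emeasure_restrict_space[OF frontier_in_sets_hausdorff] emeasure_hausdorff_measure)
qed

subsection \<open>Illumination\<close>

text \<open>A zero integral would force the nonnegative integrand to vanish almost everywhere; as
  \<open>f\<close> is positive there, \<open>A\<close> would be a null set.\<close>

lemma set_integral_pos_AE:
  fixes f :: "'b \<Rightarrow> real"
  assumes "integrable M f" "AE x in M. 0 < f x" "A \<in> sets M" "0 < emeasure M A"
  shows "0 < (LINT x:A|M. f x)"
proof -
  have int: "integrable M (\<lambda>x. indicator A x *\<^sub>R f x)"
    using assms(3,1) by (rule integrable_mult_indicator)
  have nonneg: "AE x in M. 0 \<le> indicator A x *\<^sub>R f x"
    using assms(2) by eventually_elim (auto simp: indicator_def)
  have "(LINT x:A|M. f x) \<noteq> 0"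
    unfolding set_lebesgue_integral_def integral_nonneg_eq_0_iff_AE[OF int nonneg]
  proof
    assume "AE x in M. indicator A x *\<^sub>R f x = 0"
    with assms(2) have "AE x in M. x \<notin> A"
      by eventually_elim (auto simp: indicator_def split: if_splits)
    then have "emeasure M A = 0"
      using assms(3) sets.sets_into_space[OF assms(3)] by (subst (asm) AE_iff_measurable[of A]) auto
    then show False using assms(4) by simp
  qed
  moreover have "0 \<le> (LINT x:A|M. f x)"
    unfolding set_lebesgue_integral_def using nonneg by (rule integral_nonneg_AE)
  ultimately show ?thesis by simp
qed

lemma set_integral_mono_set_AE:
  fixes f :: "'b \<Rightarrow> real"
  assumes "integrable M f" "AE x in M. 0 \<le> f x" "A \<in> sets M" "B \<in> sets M" "A \<subseteq> B"
  shows "(LINT x:A|M. f x) \<le> (LINT x:B|M. f x)"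
  unfolding set_lebesgue_integral_def
proof (rule integral_mono_AE)
  show "AE x in M. indicator A x *\<^sub>R f x \<le> indicator B x *\<^sub>R f x"
    using assms(2) by eventually_elim (use assms(5) in \<open>auto simp: indicator_def\<close>)
qed (use assms in \<open>auto intro!: integrable_mult_indicator simp del: real_scaleR_def\<close>)

section \<open>The illuminated part of the frontier\<close>

text \<open>A frontier point is a limit of points outside \<open>K\<close>, and those close enough
  to it lie in the open set \<open>interior H\<close>.\<close>

lemma frontier_Int_interior_subset_closure_Diff:
  "frontier K \<inter> interior H \<subseteq> closure (H - K)"
proof -
  have "interior H \<inter> closure (- K) \<subseteq> closure (interior H \<inter> - K)"
    by (rule open_Int_closure_subset) simp
  also have "\<dots> \<subseteq> closure (H - K)"
    using interior_subset[of H] by (intro closure_mono) auto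
  finally show ?thesis by (auto simp: frontier_closures)
qed

text \<open>The homothety with centre \<open>x\<close> and ratio \<open>1 - \<tau>\<close> maps
  \<open>p\<close> to the crossing point and \<open>ball p r\<close> onto the ball of radius
  \<open>(1 - \<tau>) * r\<close> around it; its images of points of \<open>K\<close> stay in the
  hull.\<close>

lemma illuminated_frontier_ball:
  fixes K :: "'a::real_normed_vector set"
  assumes "closed K" "0 < r" "ball p r \<subseteq> K" "x \<notin> K"
  obtains \<tau> where "0 \<le> \<tau>" "\<tau> < 1" "p + \<tau> *\<^sub>R (x - p) \<in> frontier K"
    "frontier K \<inter> ball (p + \<tau> *\<^sub>R (x - p)) ((1 - \<tau>) * r) \<subseteq> closure (convex hull (insert x K) - K)"
proof -
  let ?H = "convex hull (insert x K)"
  have "p \<in> K" using assms by auto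
  then have "closed_segment p x \<inter> frontier K \<noteq> {}"
    using \<open>x \<notin> K\<close> by (intro connected_Int_frontier) auto
  then obtain y where y: "y \<in> frontier K" "y \<in> closed_segment p x" by blast
  then obtain \<tau> where \<tau>: "0 \<le> \<tau>" "\<tau> \<le> 1" "y = (1 - \<tau>) *\<^sub>R p + \<tau> *\<^sub>R x" by (auto simp: in_segment)
  have y_eq: "y = p + \<tau> *\<^sub>R (x - p)" using \<tau>(3) by (simp add: algebra_simps)
  have "y \<in> K" using y(1) \<open>closed K\<close> by (simp add: frontier_def)
  then have "\<tau> \<noteq> 1" using \<tau>(3) \<open>x \<notin> K\<close> by auto
  then have "\<tau> < 1" using \<tau>(2) by simp
  have "ball y ((1 - \<tau>) * r) \<subseteq> ?H"
  proof
    fix q assume q: "q \<in> ball y ((1 - \<tau>) * r)"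
    \<comment> \<open>The preimage of \<open>q\<close> under the homothety.\<close>
    define w where "w = p + (1 / (1 - \<tau>)) *\<^sub>R (q - y)"
    have "norm (q - y) < (1 - \<tau>) * r" using q by (simp add: dist_norm norm_minus_commute)
    then have "norm ((1 / (1 - \<tau>)) *\<^sub>R (q - y)) < r"
      using \<open>\<tau> < 1\<close> by (simp add: pos_divide_less_eq mult.commute del: scaleR_diff_right)
    then have "w \<in> K" using assms(3) by (auto simp: w_def dist_norm)
    moreover have "(1 - \<tau>) *\<^sub>R w + \<tau> *\<^sub>R x = q"
      using \<tau>(3) \<open>\<tau> < 1\<close> by (simp add: w_def scaleR_add_right)
    moreover have "(1 - \<tau>) *\<^sub>R w + \<tau> *\<^sub>R x \<in> ?H" if "w \<in> K"
      using that \<tau> by (intro convexD[OF convex_convex_hull] hull_inc) auto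
    ultimately show "q \<in> ?H" by simp
  qed
  then have "ball y ((1 - \<tau>) * r) \<subseteq> interior ?H" by (simp add: interior_maximal)
  then have "frontier K \<inter> ball y ((1 - \<tau>) * r) \<subseteq> closure (?H - K)"
    using frontier_Int_interior_subset_closure_Diff[of K ?H] by blast
  then show thesis using that[of \<tau>] \<tau>(1) \<open>\<tau> < 1\<close> y(1) y_eq by simp
qed

section \<open>Level zero and boundedness at small levels\<close>

theorem lemma3p2:
  fixes K :: "'a::euclidean_space set" and f :: "'a \<Rightarrow> real"
  assumes "convex_body K"
    and "centroid K = 0"
    and "integrable (surface_measure K) f"
    and "AE y in surface_measure K. f y > 0"
  shows "K = illumination_surface_body K f 0 \<and>
    (\<exists>s0>0. \<forall>s. 0 \<le> s \<and> s \<le> s0 \<longrightarrow> bounded (illumination_surface_body K f s))"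
proof -
  have K: "compact K" "closed K" "convex K"
    using assms(1) by (auto simp: convex_body_def compact_imp_closed)
  obtain p r where r: "0 < r" "ball p r \<subseteq> K"
    using assms(1) by (auto simp: convex_body_def mem_interior)
  then have "p \<in> K" by auto
  define L where "L x = frontier K \<inter> closure (convex hull (insert x K) - K)" for x
  define \<mu> where "\<mu> = weighted_surface_measure K f"
  have body: "x \<in> illumination_surface_body K f s \<longleftrightarrow> \<mu> (L x) \<le> s" for x s
    by (simp add: illumination_surface_body_def L_def \<mu>_def)
  have \<mu>_pos: "0 < \<mu> (frontier K \<inter> ball y \<rho>)" if "y \<in> frontier K" "0 < \<rho>" for y \<rho>
    unfolding \<mu>_def weighted_surface_measure_def
    by (intro set_integral_pos_AE assms emeasure_surface_measure_ball_pos
        frontier_Int_borel_in_sets_surface_measure that) simp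
  have \<mu>_L: "\<mu> (frontier K \<inter> ball y \<rho>) \<le> \<mu> (L x)" if "frontier K \<inter> ball y \<rho> \<subseteq> L x" for x y \<rho>
    unfolding \<mu>_def weighted_surface_measure_def
  proof (rule set_integral_mono_set_AE[OF assms(3) _ _ _ that])
    show "AE x in surface_measure K. 0 \<le> f x" using assms(4) by eventually_elim simp
    show "L x \<in> sets (surface_measure K)"
      unfolding L_def by (rule frontier_Int_borel_in_sets_surface_measure) (simp add: borel_closed)
  qed (simp add: frontier_Int_borel_in_sets_surface_measure)
  have lit: "\<exists>\<tau>. 0 \<le> \<tau> \<and> \<tau> < 1 \<and> p + \<tau> *\<^sub>R (x - p) \<in> frontier K \<and>
      frontier K \<inter> ball (p + \<tau> *\<^sub>R (x - p)) ((1 - \<tau>) * r) \<subseteq> L x" if "x \<notin> K" for x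
    using illuminated_frontier_ball[OF K(2) r that] unfolding L_def by (metis Int_subset_iff Int_lower1)
  have "K = illumination_surface_body K f 0"
  proof (intro equalityI subsetI)
    fix x assume "x \<in> K"
    \<comment> \<open>Hence nothing is illuminated from a point of \<open>K\<close>, and the weight
      is that of the empty set.\<close>
    then have "convex hull (insert x K) = K" using K(3) by (simp add: insert_absorb hull_same)
    then show "x \<in> illumination_surface_body K f 0"
      by (simp add: body L_def \<mu>_def weighted_surface_measure_def set_lebesgue_integral_def)
  next
    fix x assume x: "x \<in> illumination_surface_body K f 0"
    show "x \<in> K"
    proof (rule ccontr)
      assume "x \<notin> K"
      from lit[OF this] obtain \<tau> where "\<tau> < 1" "p + \<tau> *\<^sub>R (x - p) \<in> frontier K"
        "frontier K \<inter> ball (p + \<tau> *\<^sub>R (x - p)) ((1 - \<tau>) * r) \<subseteq> L x" by blast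
      then have "0 < \<mu> (L x)" using r(1) by (intro less_le_trans[OF \<mu>_pos \<mu>_L]) auto
      then show False using x by (simp add: body)
    qed
  qed
  moreover have "\<exists>s0>0. \<forall>s. 0 \<le> s \<and> s \<le> s0 \<longrightarrow> bounded (illumination_surface_body K f s)"
  proof -
    obtain D where D: "0 < D" "\<And>y. y \<in> K \<Longrightarrow> dist p y \<le> D"
    proof -
      obtain e where "0 < e" "K \<subseteq> ball p e"
        using bounded_subset_ballD[OF compact_imp_bounded[OF K(1)]] by blast
      then show thesis using that[of e] 
        by (metis less_imp_le mem_ball subsetD)
    qed
    obtain I where I: "I \<subseteq> frontier K" "finite I" "frontier K \<subseteq> (\<Union>z\<in>I. ball z (r / 4))"
    proof (rule compactE_image[of "frontier K" "frontier K" "\<lambda>z. ball z (r / 4)"])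
      show "frontier K \<subseteq> (\<Union>z\<in>frontier K. ball z (r / 4))" using r(1) by force
    qed (use K(1) that in auto)
    \<comment> \<open>Inserting 1 guarantees a nonempty set for \<open>Min\<close>; halving makes
      \<open>s0\<close> strictly smaller than every weight.\<close>
    define s0 where "s0 = Min (insert 1 ((\<lambda>z. \<mu> (frontier K \<inter> ball z (r / 4))) ` I)) / 2"
    have "0 < s0"
      using I(1,2) r(1) \<mu>_pos by (auto simp: s0_def)
    have s0: "s0 < \<mu> (frontier K \<inter> ball z (r / 4))" if "z \<in> I" for z
    proof -
      have "2 * s0 \<le> \<mu> (frontier K \<inter> ball z (r / 4))"
        using I(2) that unfolding s0_def by simp
      then show ?thesis using \<open>0 < s0\<close> by simp
    qed
    have "illumination_surface_body K f s \<subseteq> cball p (2 * D)" if "s \<le> s0" for s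
    proof (rule subsetI, rule ccontr)
      fix x assume x: "x \<in> illumination_surface_body K f s" and "x \<notin> cball p (2 * D)"
      then have far: "2 * D < norm (x - p)" by (simp add: dist_norm norm_minus_commute)
      then have "x \<notin> K" using D by (force simp: dist_norm norm_minus_commute)
      from lit[OF this] obtain \<tau> where \<tau>: "0 \<le> \<tau>" "\<tau> < 1" "p + \<tau> *\<^sub>R (x - p) \<in> frontier K"
        "frontier K \<inter> ball (p + \<tau> *\<^sub>R (x - p)) ((1 - \<tau>) * r) \<subseteq> L x" by blast
      let ?y = "p + \<tau> *\<^sub>R (x - p)"
      have "?y \<in> K" using \<tau>(3) K(2) by (simp add: frontier_def)
      then have "\<tau> * norm (x - p) \<le> D" using D(2) \<tau>(1) by (fastforce simp: dist_norm)
      \<comment> \<open>The crossing point lies in \<open>K\<close>, so it is within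
        \<open>D\<close> of \<open>p\<close>, whereas \<open>x\<close> is farther than
        \<open>2 * D\<close>.\<close>
      have "\<tau> \<le> 1 / 2"
      proof (rule ccontr)
        assume "\<not> \<tau> \<le> 1 / 2"
        then have "1 / 2 * norm (x - p) \<le> \<tau> * norm (x - p)" by (intro mult_right_mono) auto
        then show False using \<open>\<tau> * norm (x - p) \<le> D\<close> far by simp
      qed
      then have "1 / 2 * r \<le> (1 - \<tau>) * r" using r(1) by (intro mult_right_mono) auto
      obtain z where z: "z \<in> I" "dist z ?y < r / 4" using I(3) \<tau>(3) by force
      \<comment> \<open>\<open>r / 4 + r / 4 = r / 2\<close>, which is at most the illuminated
        radius because \<open>\<tau> \<le> 1 / 2\<close>.\<close>
      have "ball z (r / 4) \<subseteq> ball ?y ((1 - \<tau>) * r)"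
      proof
        fix q assume "q \<in> ball z (r / 4)"
        then have "dist ?y q < 1 / 2 * r"
          using z(2) dist_triangle[of ?y q z] by (simp add: dist_commute)
        also note \<open>1 / 2 * r \<le> (1 - \<tau>) * r\<close>
        finally show "q \<in> ball ?y ((1 - \<tau>) * r)" by simp
      qed
      then have "\<mu> (frontier K \<inter> ball z (r / 4)) \<le> \<mu> (L x)" using \<tau>(4) by (intro \<mu>_L) blast
      then show False using s0[OF z(1)] x that by (simp add: body)
    qed
    then have "bounded (illumination_surface_body K f s)" if "s \<le> s0" for s
      using that by (intro bounded_subset[OF bounded_cball]) auto
    then show ?thesis using \<open>0 < s0\<close> by auto
  qed
  ultimately show ?thesis ..
qed

end
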